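(* Let $I=(i_1,\ldots,i_r)$ be a composition of $n$, and let $D_{\le I}$ be the set of $\sigma\in\mathfrak S_n$ whose descent set $\{j:\sigma(j)>\sigma(j+1)\}$ is contained in $\{i_1,i_1+i_2,\ldots,i_1+\cdots+i_{r-1}\}$. Then, in the free associative algebra on the noncommuting letters $a_0,a_1,a_2,\ldots$, $$\sum_{\sigma\in D_{\le I}} a_{\operatorname{Ic}(\sigma^{-1})}=\sum_{\sigma\in \operatorname{id}_{i_1}\Cup\cdots\Cup\operatorname{id}_{i_r}} a_{\operatorname{Ic}(\sigma)}=S_{i_1}(A_{i_2+\cdots+i_r})\,S_{i_2}(A_{i_3+\cdots+i_r})\cdots S_{i_{r-1}}(A_{i_r})\,S_{i_r}(A_0).$$
   Context: Permutations are words $\sigma=\sigma(1)\cdots\sigma(n)$. The set $\operatorname{id}_{i_1}\Cup\cdots\Cup\operatorname{id}_{i_r}$ is the set of $\sigma\in\mathfrak S_n$ such that for each $p$ the letters $s_{p-1}+1,\ldots,s_p$ (with $s_p=i_1+\cdots+i_p$, $s_0=0$) appear in $\sigma$ from left to right in increasing order; it is the set of inverses of elements of $D_{\le I}$. For a sequence $c=(c_1,\ldots,c_n)$ of nonnegative integers, $a_c$ denotes the (noncommutative) word $a_{c_1}a_{c_2}\cdots a_{c_n}$. For $m\ge0$, $A_m$ is the ordered alphabet $a_0<a_1<\cdots<a_m$, and $S_k(A_m)$ is the sum of all nondecreasing words of length $k$ over $A_m$ (i.e. all $a_{j_1}\cdots a_{j_k}$ with $0\le j_1\le\cdots\le j_k\le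 m$). Invcode: $\operatorname{Ic}(\sigma)=(a_1,\ldots,a_n)$ where the $i$-th entry is the number of values greater than $i$ to the left of $i$ in $\sigma$. *)

theory Defs
  imports "HOL-Library.Poly_Mapping" "HOL-Combinatorics.Permutations"
begin

text \<open>
  The free associative algebra over a commutative ring is the monoid algebra of the free monoid.
  The product of \<^type>\<open>poly_mapping\<close> is convolution along an additively written monoid, so
  concatenation of words is written \<open>+\<close> and the empty word \<open>0\<close>; this addition is not commutative.
\<close>

datatype 'x free_monoid = FWord (letters: "'x list")

instantiation free_monoid :: (type) monoid_add
begin

definition zero_free_monoid :: "'a free_monoid" where
  "0 = FWord []"

definition plus_free_monoid :: "'a free_monoid \<Rightarrow> 'a free_monoid \<Rightarrow> 'a free_monoid" where
  "u + v = FWord (letters u @ letters v)"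

instance
  by standard (simp_all add: zero_free_monoid_def plus_free_monoid_def)

end

type_synonym ('x, 'k) free_algebra = "'x free_monoid \<Rightarrow>\<^sub>0 'k"

text \<open>The letter $a_i$, and the word $a_c = a_{c_1} \cdots a_{c_n}$.\<close>

definition letter :: "nat \<Rightarrow> (nat, 'k::comm_ring_1) free_algebra" where
  "letter i = Poly_Mapping.single (FWord [i]) 1"

definition word_of :: "nat list \<Rightarrow> (nat, 'k::comm_ring_1) free_algebra" where
  "word_of c = prod_list (map letter c)"

lemma word_of_eq_single:
  "(word_of c :: (nat, 'k::comm_ring_1) free_algebra) = Poly_Mapping.single (FWord c) 1"
proof (induction c)
  case Nil
  have "(1 :: (nat, 'k) free_algebra) = Poly_Mapping.single 0 1"
    by simp
  then show ?case
    by (simp add: word_of_def zero_free_monoid_def)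
next
  case (Cons i c)
  then show ?case
    by (simp add: word_of_def letter_def mult_single plus_free_monoid_def)
qed

text \<open>$S_k(A_m)$, for the alphabet $a_0 < a_1 < \cdots < a_m$.\<close>

definition nondecreasing_words :: "nat \<Rightarrow> nat \<Rightarrow> nat list set" where
  "nondecreasing_words k m = {js. length js = k \<and> sorted js \<and> set js \<subseteq> {0..m}}"

definition S :: "nat \<Rightarrow> nat \<Rightarrow> (nat, 'k::comm_ring_1) free_algebra" where
  "S k m = (\<Sum>js\<in>nondecreasing_words k m. word_of js)"

lemma finite_nondecreasing_words: "finite (nondecreasing_words k m)"
  by (rule finite_subset[OF _ finite_lists_length_eq[of "{0..m}" k]])
     (auto simp: nondecreasing_words_def)

definition is_composition :: "nat list \<Rightarrow> nat \<Rightarrow> bool" where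
  "is_composition I n \<longleftrightarrow> (\<forall>i\<in>set I. 0 < i) \<and> sum_list I = n"

text \<open>$s_p = i_1 + \cdots + i_p$.\<close>

definition psum :: "nat list \<Rightarrow> nat \<Rightarrow> nat" where
  "psum I p = sum_list (take p I)"

text \<open>
  A permutation of $\{1,\dots,n\}$ is a function \<open>\<sigma>\<close> with \<open>\<sigma> permutes {1..n}\<close>, read as the word
  $\sigma(1)\cdots\sigma(n)$; the position of the letter \<open>v\<close> in this word is \<open>inv \<sigma> v\<close>.
\<close>

definition descent_set :: "nat \<Rightarrow> (nat \<Rightarrow> nat) \<Rightarrow> nat set" where
  "descent_set n \<sigma> = {j \<in> {1..<n}. \<sigma> j > \<sigma> (j + 1)}"

definition D_le :: "nat list \<Rightarrow> (nat \<Rightarrow> nat) set" where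
  "D_le I = {\<sigma>. \<sigma> permutes {1..sum_list I} \<and>
               descent_set (sum_list I) \<sigma> \<subseteq> psum I ` {1..<length I}}"

definition id_shuffles :: "nat list \<Rightarrow> (nat \<Rightarrow> nat) set" where
  "id_shuffles I = {\<sigma>. \<sigma> permutes {1..sum_list I} \<and>
     (\<forall>p\<in>{1..length I}. \<forall>u v. psum I (p - 1) + 1 \<le> u \<and> u < v \<and> v \<le> psum I p
        \<longrightarrow> inv \<sigma> u < inv \<sigma> v)}"

definition invcode :: "nat \<Rightarrow> (nat \<Rightarrow> nat) \<Rightarrow> nat list" where
  "invcode n \<sigma> = map (\<lambda>i. card {v \<in> {1..n}. v > i \<and> inv \<sigma> v < inv \<sigma> i}) [1..<Suc n]"

end

theory Submission
  imports Defs
begin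

text \<open>
  The invcode of \<open>\<sigma>\<close> is the Lehmer code of \<open>\<tau> = \<sigma>\<^sup>-\<^sup>1\<close>. Lehmer codes enumerate bijectively
  the words $c_1 \cdots c_n$ with $c_j \le n - j$, and $\tau(j) > \tau(j+1)$ holds exactly when
  $c_j > c_{j+1}$. Hence the codes of \<open>D_le I\<close> are the words that satisfy these bounds and are
  nondecreasing on each block of \<open>I\<close>. On a nondecreasing block the bound at its last letter implies
  the others, so the blocks range independently over the nondecreasing words in the alphabets
  $A_{i_{p+1} + \cdots + i_r}$.
\<close>

section \<open>Lehmer codes and their bijection with bounded words\<close>

definition lehmer_code :: "nat \<Rightarrow> (nat \<Rightarrow> nat) \<Rightarrow> nat list" where
  "lehmer_code n \<tau> = map (\<lambda>i. card {v \<in> {1..n}. v > i \<and> \<tau> v < \<tau> i}) [1..<Suc n]"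

lemma invcode_eq_lehmer_code: "invcode n \<sigma> = lehmer_code n (inv \<sigma>)"
  by (simp add: invcode_def lehmer_code_def)

lemma length_lehmer_code [simp]: "length (lehmer_code n \<tau>) = n"
  by (simp add: lehmer_code_def)

lemma nth_lehmer_code:
  assumes "j < n"
  shows "lehmer_code n \<tau> ! j = card {v \<in> {1..n}. v > Suc j \<and> \<tau> v < \<tau> (Suc j)}"
proof -
  have "[1..<Suc n] ! j = Suc j"
    using assms by (subst nth_upt) auto
  then show ?thesis
    using assms unfolding lehmer_code_def by (subst nth_map) auto
qed

definition subexcedant_words :: "nat \<Rightarrow> nat list set" where
  "subexcedant_words n = {c. length c = n \<and> (\<forall>j<n. c ! j \<le> n - 1 - j)}"

text \<open>Deleting the first letter shifts the indices by one and preserves the remaining bounds,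
  while that letter ranges freely over 0..n. This recursion yields the count n!.\<close>

lemma subexcedant_words_Suc:
  "subexcedant_words (Suc n) = (\<lambda>(a, c). a # c) ` ({..n} \<times> subexcedant_words n)"
proof (intro equalityI subsetI)
  fix c assume c: "c \<in> subexcedant_words (Suc n)"
  then obtain a d where d: "c = a # d" "length d = n"
    by (auto simp: subexcedant_words_def length_Suc_conv)
  have bnd: "c ! j \<le> n - j" if "j < Suc n" for j
    using c that by (simp add: subexcedant_words_def)
  have "a \<le> n"
    using bnd[of 0] d by simp
  moreover have "d ! j \<le> n - 1 - j" if "j < n" for j
    using bnd[of "Suc j"] d that by simp
  ultimately show "c \<in> (\<lambda>(a, c). a # c) ` ({..n} \<times> subexcedant_words n)"
    using d by (auto simp: subexcedant_words_def)
qed (auto simp: subexcedant_words_def nth_Cons split: nat.splits)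

lemma finite_card_subexcedant_words:
  "finite (subexcedant_words n) \<and> card (subexcedant_words n) = fact n"
proof (induction n)
  case 0
  have "subexcedant_words 0 = {[]}"
    by (auto simp: subexcedant_words_def)
  then show ?case by simp
next
  case (Suc n)
  have "inj_on (\<lambda>(a, c). a # c) ({..n} \<times> subexcedant_words n)"
    by (auto simp: inj_on_def)
  then show ?case
    using Suc by (simp add: subexcedant_words_Suc card_image card_cartesian_product)
qed

lemma lehmer_code_in_subexcedant_words: "lehmer_code n \<tau> \<in> subexcedant_words n"
proof -
  have "lehmer_code n \<tau> ! j \<le> n - 1 - j" if "j < n" for j
  proof -
    have "card {v \<in> {1..n}. v > Suc j \<and> \<tau> v < \<tau> (Suc j)} \<le> card {Suc j<..n}"
      by (rule card_mono) auto
    then show ?thesis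
      using that by (simp add: nth_lehmer_code)
  qed
  then show ?thesis
    by (simp add: subexcedant_words_def)
qed

text \<open>For v < w in \<open>R\<close>, the rank of w counts v in addition to everything below v,
  so ranks increase strictly and a value can be recovered from its rank.\<close>

lemma inj_on_card_less:
  fixes R :: "'a::linorder set"
  assumes "finite R"
  shows "inj_on (\<lambda>w. card {x \<in> R. x < w}) R"
proof -
  have "card {x \<in> R. x < v} < card {x \<in> R. x < w}" if "v < w" "v \<in> R" for v w
    using assms that by (intro psubset_card_mono) auto
  then show ?thesis
    by (intro linorder_inj_onI') (simp add: less_imp_neq)
qed

text \<open>Passes from positions to values: \<tau> maps the counted positions bijectively onto the
  smaller values not taken at positions 1..j. The value at \<open>Suc j\<close> is still in that
  pool, but the strict inequality keeps it out of the count.\<close>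

lemma lehmer_code_eq_rank:
  assumes "\<tau> permutes {1..n}" "j < n"
  shows "lehmer_code n \<tau> ! j = card {w \<in> {1..n} - \<tau> ` {1..j}. w < \<tau> (Suc j)}"
proof -
  have inj: "inj \<tau>"
    using assms(1) by (rule permutes_inj)
  have "{w \<in> {1..n} - \<tau> ` {1..j}. w < \<tau> (Suc j)}
      = \<tau> ` {v \<in> {1..n}. v > Suc j \<and> \<tau> v < \<tau> (Suc j)}"
  proof (intro equalityI subsetI)
    fix w assume w: "w \<in> {w \<in> {1..n} - \<tau> ` {1..j}. w < \<tau> (Suc j)}"
    then obtain v where v: "v \<in> {1..n}" "w = \<tau> v"
      using permutes_image[OF assms(1)] by blast
    with w have "v \<notin> {1..j}" "v \<noteq> Suc j"
      by auto
    with v w show "w \<in> \<tau> ` {v \<in> {1..n}. v > Suc j \<and> \<tau> v < \<tau> (Suc j)}"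
      by auto
  next
    fix w assume "w \<in> \<tau> ` {v \<in> {1..n}. v > Suc j \<and> \<tau> v < \<tau> (Suc j)}"
    then obtain v where v: "v \<in> {1..n}" "v > Suc j" "\<tau> v < \<tau> (Suc j)" "w = \<tau> v"
      by blast
    have "\<tau> v \<in> {1..n}"
      using v(1) permutes_in_image[OF assms(1)] by blast
    moreover have "\<tau> v \<notin> \<tau> ` {1..j}"
      using v(2) by (auto simp: inj_eq[OF inj])
    ultimately show "w \<in> {w \<in> {1..n} - \<tau> ` {1..j}. w < \<tau> (Suc j)}"
      using v by simp
  qed
  then show ?thesis
    using assms(2) inj by (simp add: nth_lehmer_code card_image inj_on_subset)
qed

text \<open>
  The code determines \<open>\<tau>\<close> from left to right: it gives the rank of the next value among the values
  not taken yet.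
\<close>

lemma inj_on_lehmer_code: "inj_on (lehmer_code n) {\<tau>. \<tau> permutes {1..n}}"
proof (rule inj_onI)
  fix \<tau> \<tau>' assume perm: "\<tau> \<in> {\<tau>. \<tau> permutes {1..n}}" "\<tau>' \<in> {\<tau>. \<tau> permutes {1..n}}"
    and eq: "lehmer_code n \<tau> = lehmer_code n \<tau>'"
  have avail: "\<rho> (Suc j) \<in> {1..n} - \<rho> ` {1..j}" if "\<rho> permutes {1..n}" "j < n" for \<rho> j
    using that permutes_in_image[OF that(1), of "Suc j"]
    by (auto simp: inj_eq[OF permutes_inj[OF that(1)]])
  have "\<tau> i = \<tau>' i" if "i \<in> {1..n}" for i
    using that
  proof (induction i rule: less_induct)
    case (less i)
    then obtain j where i: "i = Suc j" "j < n"
      by (cases i) auto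
    \<comment> \<open>By the induction hypothesis both permutations leave the same pool of values,
      so equal ranks in it force equal values.\<close>
    define R where "R = {1..n} - \<tau> ` {1..j}"
    have "\<tau> ` {1..j} = \<tau>' ` {1..j}"
      using less i by (intro image_cong) auto
    then have R': "R = {1..n} - \<tau>' ` {1..j}"
      by (simp add: R_def)
    have "card {w \<in> R. w < \<tau> i} = card {w \<in> R. w < \<tau>' i}"
      using lehmer_code_eq_rank[of \<tau> n j, folded R_def]
        lehmer_code_eq_rank[of \<tau>' n j, folded R'] perm i eq
      by (metis mem_Collect_eq)
    moreover have "\<tau> i \<in> R" "\<tau>' i \<in> R"
      using avail[of \<tau> j] avail[of \<tau>' j] perm i R' by (auto simp: R_def)
    moreover have "finite R"
      by (simp add: R_def)
    ultimately show ?case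
      using inj_onD[OF inj_on_card_less] by blast
  qed
  then show "\<tau> = \<tau>'"
    using perm by (intro ext) (metis mem_Collect_eq permutes_not_in)
qed

text \<open>Counting replaces the construction of an inverse: the n! permutations have distinct
  codes, all lying in a set of n! words.\<close>

lemma lehmer_code_image: "lehmer_code n ` {\<tau>. \<tau> permutes {1..n}} = subexcedant_words n"
proof (rule card_subset_eq)
  show "card (lehmer_code n ` {\<tau>. \<tau> permutes {1..n}}) = card (subexcedant_words n)"
    using finite_card_subexcedant_words[of n] card_permutations[of "{1..n}" n]
    by (subst card_image[OF inj_on_lehmer_code]) simp
qed (use finite_card_subexcedant_words lehmer_code_in_subexcedant_words in auto)

text \<open>At a descent, every position counted for \<open>Suc (Suc j)\<close> is also counted for
  \<open>Suc j\<close>, and so is \<open>Suc (Suc j)\<close> itself, hence a strict drop. At an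
  ascent that position is not counted and the inclusion is reversed.\<close>

lemma lehmer_code_descent_iff:
  assumes "\<tau> permutes {1..n}" "Suc j < n"
  shows "lehmer_code n \<tau> ! j > lehmer_code n \<tau> ! Suc j \<longleftrightarrow> \<tau> (Suc j) > \<tau> (Suc (Suc j))"
proof -
  let ?A = "\<lambda>j. {v \<in> {1..n}. v > Suc j \<and> \<tau> v < \<tau> (Suc j)}"
  have "\<tau> (Suc j) \<noteq> \<tau> (Suc (Suc j))"
    by (simp add: inj_eq[OF permutes_inj[OF assms(1)]])
  then consider "\<tau> (Suc j) > \<tau> (Suc (Suc j))" | "\<tau> (Suc j) < \<tau> (Suc (Suc j))"
    by linarith
  then show ?thesis
  proof cases
    case 1
    then have "Suc (Suc j) \<in> ?A j - ?A (Suc j)" "?A (Suc j) \<subseteq> ?A j"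
      using assms(2) by auto
    then have "card (?A (Suc j)) < card (?A j)"
      by (intro psubset_card_mono) auto
    then show ?thesis
      using 1 assms(2) by (simp add: nth_lehmer_code)
  next
    case 2
    have "v \<in> ?A (Suc j)" if "v \<in> ?A j" for v
    proof -
      from that 2 have "v \<noteq> Suc (Suc j)"
        by auto
      with that 2 show ?thesis
        by auto
    qed
    then have "card (?A j) \<le> card (?A (Suc j))"
      by (intro card_mono) auto
    then show ?thesis
      using 2 assms(2) by (simp add: nth_lehmer_code)
  qed
qed

section \<open>Partial sums, and shuffles as inverses of permutations with restricted
  descents\<close>

lemma psum_Cons_Suc [simp]: "psum (i # J) (Suc p) = i + psum J p"
  by (simp add: psum_def)

lemma psum_0 [simp]: "psum I 0 = 0"
  by (simp add: psum_def)

lemma psum_length [simp]: "psum I (length I) = sum_list I"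
  by (simp add: psum_def)

lemma psum_mono: "p \<le> q \<Longrightarrow> psum I p \<le> psum I q"
  by (auto simp: psum_def le_iff_add take_add)

text \<open>Including the partial sum \<open>psum I 0 = 0\<close> makes the set of breaks recursive in \<open>I\<close>.\<close>

lemma psum_image_Cons:
  "psum (i # J) ` {..<length (i # J)} = insert 0 ((+) i ` psum J ` {..<length J})"
  by (simp add: lessThan_Suc_eq_insert_0 image_image)

lemma mem_psum_image_iff:
  assumes "0 < j"
  shows "j \<in> psum I ` {1..<length I} \<longleftrightarrow> j \<in> psum I ` {..<length I}"
proof
  assume "j \<in> psum I ` {..<length I}"
  then obtain p where "j = psum I p" "p < length I"
    by blast
  moreover from this assms have "p \<noteq> 0"
    by (intro notI) simp
  ultimately show "j \<in> psum I ` {1..<length I}"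
    by auto
qed auto

text \<open>Applied to \<open>f = inv \<sigma>\<close>, this turns the shuffle condition into a
  descent condition. Increase along a block is a chain of adjacent ascents, so descents can occur
  only at block ends.\<close>

lemma ascending_on_blocks_iff:
  fixes f :: "nat \<Rightarrow> 'a::linorder"
  assumes "inj f"
  shows "(\<forall>p\<in>{1..length I}. \<forall>u v. psum I (p - 1) + 1 \<le> u \<and> u < v \<and> v \<le> psum I p \<longrightarrow> f u < f v)
     \<longleftrightarrow> {j \<in> {1..<sum_list I}. f j > f (j + 1)} \<subseteq> psum I ` {1..<length I}"
    (is "?blocks \<longleftrightarrow> ?desc")
proof
  assume blocks: ?blocks
  show ?desc
  proof
    fix j assume j: "j \<in> {j \<in> {1..<sum_list I}. f j > f (j + 1)}"
    \<comment> \<open>The block containing j; its end is the only place in it where a descent is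
      possible.\<close>
    define p where "p = (LEAST p. j \<le> psum I p)"
    have ex: "j \<le> psum I (length I)"
      using j by simp
    have p: "j \<le> psum I p" "p \<le> length I"
      using LeastI[of "\<lambda>p. j \<le> psum I p", OF ex] Least_le[of "\<lambda>p. j \<le> psum I p", OF ex]
      by (simp_all add: p_def)
    have "p \<noteq> 0"
      using p j by (intro notI) simp
    then have prev: "psum I (p - 1) < j"
      using not_less_Least[of "p - 1" "\<lambda>p. j \<le> psum I p"] by (simp add: p_def)
    have "\<not> j < psum I p"
    proof
      assume "j < psum I p"
      then have "f j < f (j + 1)"
        using blocks[rule_format, of p j "j + 1"] p \<open>p \<noteq> 0\<close> prev by auto
      with j show False
        by auto
    qed
    with p have eq: "j = psum I p"
      by simp
    moreover have "p \<noteq> length I"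
      using eq j by auto
    ultimately show "j \<in> psum I ` {1..<length I}"
      using p \<open>p \<noteq> 0\<close> by auto
  qed
next
  assume desc: ?desc
  show ?blocks
  proof (intro ballI allI impI)
    fix p u v
    assume p: "p \<in> {1..length I}" and uv: "psum I (p - 1) + 1 \<le> u \<and> u < v \<and> v \<le> psum I p"
    have ascent: "f j < f (Suc j)" if "psum I (p - 1) < j" "j < psum I p" for j
    proof -
      \<comment> \<open>By monotonicity no partial sum lies strictly between two consecutive
        ones.\<close>
      have "j \<noteq> psum I q" for q
        using that psum_mono[of q "p - 1" I] psum_mono[of p q I]
        p by (cases "q < p") (force, simp)
      then have "j \<notin> psum I ` {1..<length I}"
        by blast
      moreover have "j \<in> {1..<sum_list I}"
        using that p psum_mono[of p "length I" I] by auto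
      ultimately have "f j \<le> f (Suc j)"
        using desc by fastforce
      moreover have "f j \<noteq> f (Suc j)"
        by (simp add: inj_eq[OF assms])
      ultimately show ?thesis
        by simp
    qed
    have "Suc u \<le> v"
      using uv by simp
    \<comment> \<open>The upper bound stays inside the induction formula, so that it is available
      for each intermediate endpoint.\<close>
    then have "v \<le> psum I p \<longrightarrow> f u < f v"
    proof (induction v rule: dec_induct)
      case base
      show ?case
        using uv ascent[of u] by auto
    next
      case (step m)
      then show ?case
        using uv ascent[of m] by auto
    qed
    with uv show "f u < f v"
      by simp
  qed
qed

lemma id_shuffles_iff_inv_D_le:
  "\<sigma> \<in> id_shuffles I \<longleftrightarrow> \<sigma> permutes {1..sum_list I} \<and> inv \<sigma> \<in> D_le I"
proof (cases "\<sigma> permutes {1..sum_list I}")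
  case True
  then have "inv \<sigma> permutes {1..sum_list I}"
    by (rule permutes_inv)
  then show ?thesis
    using True ascending_on_blocks_iff[OF permutes_inj, of "inv \<sigma>" "{1..sum_list I}" I]
    by (simp add: id_shuffles_def D_le_def descent_set_def)
qed (simp add: id_shuffles_def)

lemma bij_betw_inv_D_le_id_shuffles: "bij_betw inv (D_le I) (id_shuffles I)"
  by (rule bij_betw_byWitness[where f' = inv])
     (auto simp: id_shuffles_iff_inv_D_le D_le_def permutes_inv permutes_inv_inv)

section \<open>Codes of the permutations in \<open>D_le I\<close>\<close>

text \<open>List indices start at 0, so the entries at j and \<open>Suc j\<close> are separated by a
  break after \<open>Suc j\<close> letters. The breaks are taken with 0 included, the form that
  recurs along \<open>I\<close>.\<close>

definition block_codes :: "nat list \<Rightarrow> nat list set" where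
  "block_codes I = {c \<in> subexcedant_words (sum_list I).
     \<forall>j. Suc j < sum_list I \<and> Suc j \<notin> psum I ` {..<length I} \<longrightarrow> c ! j \<le> c ! Suc j}"

lemma D_le_iff_lehmer_code:
  assumes "\<tau> permutes {1..sum_list I}"
  shows "\<tau> \<in> D_le I \<longleftrightarrow> lehmer_code (sum_list I) \<tau> \<in> block_codes I"
proof -
  let ?n = "sum_list I"
  have "\<tau> \<in> D_le I \<longleftrightarrow>
      (\<forall>j\<in>{1..<?n}. \<tau> j > \<tau> (j + 1) \<longrightarrow> j \<in> psum I ` {1..<length I})"
    using assms by (auto simp: D_le_def descent_set_def)
  also have "\<dots> \<longleftrightarrow>
      (\<forall>j. Suc j < ?n \<longrightarrow> \<tau> (Suc j) > \<tau> (Suc (Suc j)) \<longrightarrow> Suc j \<in> psum I ` {1..<length I})"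
    (is "?l \<longleftrightarrow> ?r")
  proof
    assume r: ?r
    show ?l
    proof (intro ballI impI)
      fix j assume "j \<in> {1..<?n}" "\<tau> j > \<tau> (j + 1)"
      then show "j \<in> psum I ` {1..<length I}"
        using r[rule_format, of "j - 1"] by simp
    qed
  qed auto
  also have "\<dots> \<longleftrightarrow> lehmer_code ?n \<tau> \<in> block_codes I"
    using lehmer_code_descent_iff[OF assms] lehmer_code_in_subexcedant_words[of ?n \<tau>]
      mem_psum_image_iff[of "Suc _" I]
    by (auto simp: block_codes_def simp flip: not_less)
  finally show ?thesis .
qed

lemma bij_betw_lehmer_code_D_le:
  "bij_betw (lehmer_code (sum_list I)) (D_le I) (block_codes I)"
proof -
  have "lehmer_code (sum_list I) ` D_le I = block_codes I"
  proof (intro equalityI subsetI)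
    fix c assume c: "c \<in> block_codes I"
    then have "c \<in> lehmer_code (sum_list I) ` {\<tau>. \<tau> permutes {1..sum_list I}}"
      unfolding lehmer_code_image by (simp add: block_codes_def)
    with c show "c \<in> lehmer_code (sum_list I) ` D_le I"
      using D_le_iff_lehmer_code by blast
  qed (use D_le_iff_lehmer_code in \<open>auto simp: D_le_def\<close>)
  moreover have "inj_on (lehmer_code (sum_list I)) (D_le I)"
    by (rule inj_on_subset[OF inj_on_lehmer_code]) (auto simp: D_le_def)
  ultimately show ?thesis
    by (simp add: bij_betw_def)
qed

section \<open>Factorization of the codes along the blocks\<close>

lemma block_codes_Nil: "block_codes [] = {[]}"
  by (auto simp: block_codes_def subexcedant_words_def)

text \<open>The bounds on v keep their form under the shift by i, and the break at i leaves the last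
  letter of u and the first letter of v unrelated. The two factors therefore have independent
  conditions.\<close>

lemma append_in_block_codes_Cons_iff:
  assumes "0 < i" "length u = i"
  shows "u @ v \<in> block_codes (i # J)
     \<longleftrightarrow> u \<in> nondecreasing_words i (sum_list J) \<and> v \<in> block_codes J"
proof -
  let ?m = "sum_list J" and ?P = "psum J ` {..<length J}"
  have P: "k \<in> psum (i # J) ` {..<length (i # J)} \<longleftrightarrow> k = 0 \<or> k \<ge> i \<and> k - i \<in> ?P" for k
    unfolding psum_image_Cons by (auto simp: image_iff) (metis le_add_diff_inverse lessThan_iff)
  have P0: "0 \<in> ?P" if "0 < ?m"
    using that by (intro image_eqI[of _ _ 0]) auto
  have nth_u: "(u @ v) ! j = u ! j" if "j < i" for j
    using that assms by (simp add: nth_append)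
  have nth_v: "(u @ v) ! (i + j) = v ! j" for j
    using assms by (simp add: nth_append)
  show ?thesis
  proof
    assume "u @ v \<in> block_codes (i # J)"
    then have len: "length v = ?m"
      and bnd: "\<And>j. j < i + ?m \<Longrightarrow> (u @ v) ! j \<le> i + ?m - 1 - j"
      and asc: "\<And>j. Suc j < i + ?m \<Longrightarrow> Suc j \<notin> psum (i # J) ` {..<length (i # J)}
          \<Longrightarrow> (u @ v) ! j \<le> (u @ v) ! Suc j"
      using assms by (auto simp: block_codes_def subexcedant_words_def)
    have "u ! j \<le> u ! Suc j" if "Suc j < length u" for j
      using asc[of j] that assms nth_u[of j] nth_u[of "Suc j"] unfolding P by simp
    then have sorted: "sorted u"
      by (simp add: sorted_iff_nth_Suc)
    \<comment> \<open>The bound i + m - 1 - j equals m at j = i - 1; sortedness passes it on to the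
      earlier letters.\<close>
    have "u ! (i - 1) \<le> ?m"
      using bnd[of "i - 1"] nth_u[of "i - 1"] assms by simp
    then have "u ! j \<le> ?m" if "j < i" for j
      using sorted_nth_mono[OF sorted, of j "i - 1"] that assms by fastforce
    then have "u \<in> nondecreasing_words i ?m"
      using sorted assms by (auto simp: nondecreasing_words_def in_set_conv_nth)
    moreover have "v ! j \<le> ?m - 1 - j" if "j < ?m" for j
      using bnd[of "i + j"] that by (simp add: nth_v)
    moreover have "v ! j \<le> v ! Suc j" if "Suc j < ?m" "Suc j \<notin> ?P" for j
      using asc[of "i + j"] that nth_v[of j] nth_v[of "Suc j"] unfolding P by simp
    ultimately show "u \<in> nondecreasing_words i ?m \<and> v \<in> block_codes J"
      using len by (simp add: block_codes_def subexcedant_words_def)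
  next
    assume uv: "u \<in> nondecreasing_words i ?m \<and> v \<in> block_codes J"
    then have u: "sorted u" "\<And>j. j < i \<Longrightarrow> u ! j \<le> ?m"
      using assms by (auto simp: nondecreasing_words_def set_conv_nth)
    from uv have len: "length v = ?m"
      and v_bnd: "\<And>j. j < ?m \<Longrightarrow> v ! j \<le> ?m - 1 - j"
      and v_asc: "\<And>j. Suc j < ?m \<Longrightarrow> Suc j \<notin> ?P \<Longrightarrow> v ! j \<le> v ! Suc j"
      by (auto simp: block_codes_def subexcedant_words_def)
    have "(u @ v) ! j \<le> i + ?m - 1 - j" if "j < i + ?m" for j
    proof (cases "j < i")
      case True
      then show ?thesis
        using u(2)[of j] by (simp add: nth_u)
    next
      case False
      then show ?thesis
        using v_bnd[of "j - i"] nth_v[of "j - i"] that by fastforce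
    qed
    moreover have "(u @ v) ! j \<le> (u @ v) ! Suc j"
      if j: "Suc j < i + ?m" "Suc j \<notin> psum (i # J) ` {..<length (i # J)}" for j
    proof -
      consider "Suc j < i" | "Suc j = i" | "i \<le> j"
        by linarith
      then show ?thesis
      proof cases
        case 1
        then show ?thesis
          using sorted_nth_mono[OF u(1), of j "Suc j"] assms by (simp add: nth_u)
      next
        \<comment> \<open>Here v is nonempty, so by \<open>P0\<close> the boundary i is a break and
          this pair carries no condition.\<close>
        case 2
        then show ?thesis
          using j P0 unfolding P by simp
      next
        case 3
        then have "Suc (j - i) \<notin> ?P"
          using j(2) unfolding P by (simp add: Suc_diff_le)
        then show ?thesis
          using 3 j(1) v_asc[of "j - i"] nth_v[of "j - i"] nth_v[of "Suc (j - i)"] by simp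
      qed
    qed
    ultimately show "u @ v \<in> block_codes (i # J)"
      using len assms by (simp add: block_codes_def subexcedant_words_def)
  qed
qed

lemma block_codes_Cons:
  assumes "0 < i"
  shows "block_codes (i # J) = (\<lambda>(u, v). u @ v) ` (nondecreasing_words i (sum_list J) \<times> block_codes J)"
proof (intro equalityI subsetI)
  fix c assume c: "c \<in> block_codes (i # J)"
  then have "length (take i c) = i"
    by (simp add: block_codes_def subexcedant_words_def)
  then have "take i c \<in> nondecreasing_words i (sum_list J) \<and> drop i c \<in> block_codes J"
    using append_in_block_codes_Cons_iff[OF assms, of "take i c" "drop i c" J] c by simp
  then show "c \<in> (\<lambda>(u, v). u @ v) ` (nondecreasing_words i (sum_list J) \<times> block_codes J)"
    by (intro image_eqI[of _ _ "(take i c, drop i c)"]) auto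
next
  fix c assume "c \<in> (\<lambda>(u, v). u @ v) ` (nondecreasing_words i (sum_list J) \<times> block_codes J)"
  then show "c \<in> block_codes (i # J)"
    using append_in_block_codes_Cons_iff[OF assms]
    by (auto simp: nondecreasing_words_def)
qed

lemma sum_block_codes:
  assumes "\<forall>i\<in>set I. 0 < i"
  shows "(\<Sum>c\<in>block_codes I. word_of c :: (nat, 'k::comm_ring_1) free_algebra)
    = prod_list (map (\<lambda>p. S (I ! p) (sum_list (drop (Suc p) I))) [0..<length I])"
  using assms
proof (induction I)
  case Nil
  show ?case
    by (simp add: block_codes_Nil word_of_def)
next
  case (Cons i J)
  let ?N = "nondecreasing_words i (sum_list J)"
  \<comment> \<open>All left factors have length i, so a concatenation determines its
    factors.\<close>
  have inj: "inj_on (\<lambda>(u, v). u @ v) (?N \<times> block_codes J)"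
    by (auto simp: inj_on_def nondecreasing_words_def)
  have "(\<Sum>c\<in>block_codes (i # J). word_of c :: (nat, 'k) free_algebra)
      = (\<Sum>(u, v)\<in>?N \<times> block_codes J. word_of u * word_of v)"
    using Cons.prems sum.reindex[OF inj, of word_of]
    by (simp add: block_codes_Cons case_prod_unfold word_of_def)
  also have "\<dots> = S i (sum_list J) * (\<Sum>c\<in>block_codes J. word_of c)"
    by (simp add: S_def sum_product sum.cartesian_product)
  finally show ?case
    \<comment> \<open>Splitting off index 0 of the product leaves the factors of \<open>J\<close>
      with indices shifted by one.\<close>
    using Cons by (simp add: upt_conv_Cons map_Suc_upt[symmetric] comp_def del: upt_Suc)
qed

theorem mainTheorem4:
  fixes I :: "nat list" and n :: nat
  assumes "is_composition I n"
  shows "(\<Sum>\<sigma>\<in>D_le I. word_of (invcode n (inv \<sigma>)) :: (nat, 'k::comm_ring_1) free_algebra)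
           = (\<Sum>\<sigma>\<in>id_shuffles I. word_of (invcode n \<sigma>))
       \<and> (\<Sum>\<sigma>\<in>id_shuffles I. word_of (invcode n \<sigma>) :: (nat, 'k) free_algebra)
           = prod_list (map (\<lambda>p. S (I ! p) (sum_list (drop (Suc p) I))) [0..<length I])"
proof
  have n: "n = sum_list I" and pos: "\<forall>i\<in>set I. 0 < i"
    using assms by (auto simp: is_composition_def)
  show inverses: "(\<Sum>\<sigma>\<in>D_le I. word_of (invcode n (inv \<sigma>)) :: (nat, 'k) free_algebra)
      = (\<Sum>\<sigma>\<in>id_shuffles I. word_of (invcode n \<sigma>))"
    by (rule sum.reindex_bij_betw[OF bij_betw_inv_D_le_id_shuffles])
  \<comment> \<open>The two inversions cancel: the invcode of \<open>inv \<sigma>\<close> is the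
    Lehmer code of \<sigma> itself.\<close>
  have "(\<Sum>\<sigma>\<in>D_le I. word_of (invcode n (inv \<sigma>)) :: (nat, 'k) free_algebra)
      = (\<Sum>\<tau>\<in>D_le I. word_of (lehmer_code n \<tau>))"
    by (rule sum.cong) (auto simp: invcode_eq_lehmer_code D_le_def permutes_inv_inv)
  also have "\<dots> = (\<Sum>c\<in>block_codes I. word_of c)"
    unfolding n by (rule sum.reindex_bij_betw[OF bij_betw_lehmer_code_D_le])
  also have "\<dots> = prod_list (map (\<lambda>p. S (I ! p) (sum_list (drop (Suc p) I))) [0..<length I])"
    using pos by (rule sum_block_codes)
  finally show "(\<Sum>\<sigma>\<in>id_shuffles I. word_of (invcode n \<sigma>) :: (nat, 'k) free_algebra)
      = prod_list (map (\<lambda>p. S (I ! p) (sum_list (drop (Suc p) I))) [0..<length I])"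
    by (simp only: inverses)
qed

end
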